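(* Let $V,c_1,c_2\in\mathbb{R}_{>0}$ and let $c_0\in\mathbb{R}_{\ge0}$ with $c_2\ge c_0$. Let $\mathbf{O}\subset\mathbb{R}^2$ be a compact convex set with $\operatorname{vol}_{\mathbb{R}^2}(\mathbf{O})=V$ satisfying $$\mathbf{O}\cap\{(x_1,x_2)\in\mathbb{R}^2\mid x_1\le c_1\}=\left\{(x_1,x_2)\in\mathbb{R}^2\ \middle|\ 0\le x_1\le c_1\text{ and }0\le x_2\le\frac{c_2-c_0}{c_1}x_1+c_0\right\}$$ (in particular $c_1(c_0+c_2)/2\le V$). Let $(b_1,b_2)\in\mathbf{O}$ be the barycenter of $\mathbf{O}$. Let $p_1:\mathbb{R}^2\to\mathbb{R}$ be the projection to the first coordinate, write $p_1(\mathbf{O})=[0,t_1]$, and let $g(x)$ be the length of $(p_1|_{\mathbf{O}})^{-1}(x)$ for $x\in[0,t_1]$. (1) We have $$b_1\le\frac{c_0^2c_1^2-4c_0c_1V+2c_1c_2V+4V^2}{6c_2V}\quad\text{and}\quad b_2\le\frac{-c_0^3c_1^2+4c_0^2c_1V-4c_0V^2+4c_2V^2}{6c_1c_2V}.$$ (2) Assume that $b_1=\frac{c_0^2c_1^2-4c_0c_1V+2c_1c_2V+4V^2}{6c_2V}$. Then $t_1=(2V-c_0c_1)/c_2$ and $$g(x)=\begin{cases}\frac{c_2-c_0}{c_1}x+c_0&\text{if }x\in[0,c_1],\\ c_2\cdot\frac{t_1-x}{t_1-c_1}&\text{if }x\in[c_1,t_1].\end{cases}$$ (3) If $b_2=\frac{-c_0^3c_1^2+4c_0^2c_1V-4c_0V^2+4c_2V^2}{6c_1c_2V}$,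 then $b_1=\frac{c_0^2c_1^2-4c_0c_1V+2c_1c_2V+4V^2}{6c_2V}$. Moreover, $\mathbf{O}$ must be the convex hull of $$\left\{(0,c_0),\ (0,0),\ (c_1,0),\ \left(\frac{2V-c_0c_1}{c_2},\frac{2c_2V-c_0(2V-c_0c_1)}{c_1c_2}\right)\right\}.$$
   Context: $\operatorname{vol}_{\mathbb{R}^2}$ is Lebesgue measure; the barycenter is $(b_1,b_2)=\frac1V\int_{\mathbf{O}}(x_1,x_2)\,dx_1dx_2$. In (2), if $t_1=c_1$, the second case of the formula for $g$ is vacuous (the value at $x=c_1$ is given by the first case). *)

theory Defs
  imports "HOL-Analysis.Analysis"
begin

definition barycenter :: "(real \<times> real) set \<Rightarrow> real \<times> real" where
  "barycenter K =
     (1 / measure lborel K * (LINT p:K|lborel. fst p),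
      1 / measure lborel K * (LINT p:K|lborel. snd p))"

text \<open>The fibre of the first projection restricted to \<open>K\<close> lies on a vertical line; its length is
  the one-dimensional Lebesgue measure of its second coordinates.\<close>
definition fibre_length :: "(real \<times> real) set \<Rightarrow> real \<Rightarrow> real" where
  "fibre_length K x = measure lborel (snd ` {p \<in> K. fst p = x})"

end

theory Submission
  imports Defs
begin

text \<open>
  Convexity confines \<open>K\<close> to the region below the line extending the upper edge of the trapezoid (the
  roof), and makes the fibre length \<open>g\<close> concave. Let \<open>T = (2 V - c0 c1) / c2\<close> and let \<open>e\<close> be the
  affine function on \<open>[c1, T]\<close> falling from \<open>c2\<close> to \<open>0\<close>; it has the same integral as \<open>g\<close>.
  By concavity \<open>g - e\<close> changes sign once, from nonnegative to negative, so the integral of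
  \<open>x (g - e)\<close> is at most \<open>0\<close>, with equality only for \<open>g = e\<close>. This bounds \<open>b1\<close>.
  A fibre of length \<open>g\<close> below the roof \<open>h\<close> has moment at most
  \<open>g (h - g / 2) = e (h - e / 2) + (g - e) (h - e) - (g - e)^2 / 2\<close>, and \<open>h - e\<close> is affine with
  positive slope, so the bound for \<open>b2\<close> reduces to the one for \<open>b1\<close>. Equality forces
  \<open>g = e\<close> and all fibres right of \<open>c1\<close> to touch the roof.
\<close>

section \<open>Integration on the real line\<close>

lemma set_integral_Icc_cont:
  fixes f :: "real \<Rightarrow> real"
  assumes "continuous_on {a..b} f"
  shows "set_integrable lborel {a..b} f"
  using borel_integrable_compact[OF compact_Icc assms] by (simp add: set_integrable_def)

lemma set_integral_quadratic:
  fixes a b p q r :: real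
  assumes "a \<le> b"
  shows "(LINT x:{a..b}|lborel. p + q * x + r * x\<^sup>2) =
    p * (b - a) + q * (b\<^sup>2 - a\<^sup>2) / 2 + r * (b ^ 3 - a ^ 3) / 3"
proof -
  have "(\<integral>x. (p + q * x + r * x\<^sup>2) * indicator {a..b} x \<partial>lborel) =
      (p * b + q * b\<^sup>2 / 2 + r * b ^ 3 / 3) - (p * a + q * a\<^sup>2 / 2 + r * a ^ 3 / 3)"
  proof (rule integral_FTC_Icc_real[OF assms])
    fix x :: real
    show "DERIV (\<lambda>x. p * x + q * x\<^sup>2 / 2 + r * x ^ 3 / 3) x :> p + q * x + r * x\<^sup>2"
      by (auto intro!: derivative_eq_intros simp: power2_eq_square)
    show "isCont (\<lambda>x. p + q * x + r * x\<^sup>2) x"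
      by (intro continuous_intros)
  qed
  then show ?thesis
    by (simp add: set_lebesgue_integral_def mult.commute diff_divide_distrib right_diff_distrib)
qed

text \<open>A nonempty open interval has positive measure, so it cannot consist of exceptions. This
  turns almost-everywhere equalities into actual points as close as desired to a given one.\<close>

lemma AE_lborel_obtain:
  fixes a b :: real
  assumes "AE x in lborel. a \<le> x \<and> x \<le> b \<longrightarrow> P x" and "a \<le> c" "c < d" "d \<le> b"
  obtains x where "c < x" "x < d" "P x"
proof -
  have "\<exists>x. c < x \<and> x < d \<and> P x"
  proof (rule ccontr)
    assume "\<not> ?thesis"
    then have "AE x in lborel. x \<notin> {c<..<d}"
      using assms by (intro eventually_mono[OF assms(1)]) force
    then have "emeasure lborel {c<..<d} = 0"
      by (subst (asm) AE_iff_measurable[of "{c<..<d}"]) (auto simp: set_eq_iff)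
    then show False using \<open>c < d\<close> by simp
  qed
  then show thesis using that by blast
qed

text \<open>Multiplying a function that changes sign once, at \<open>s\<close>, by \<open>x - s\<close> makes it nonpositive.\<close>
lemma single_crossing_moment:
  fixes d :: "real \<Rightarrow> real"
  assumes int: "set_integrable lborel {a..b} d"
    and intx: "set_integrable lborel {a..b} (\<lambda>x. x * d x)"
    and zero: "(LINT x:{a..b}|lborel. d x) = 0"
    and crossing: "\<And>x y. a \<le> x \<Longrightarrow> x < y \<Longrightarrow> y < b \<Longrightarrow> 0 \<le> d y \<Longrightarrow> 0 \<le> d x"
  shows "(LINT x:{a..b}|lborel. x * d x) \<le> 0"
    and "(LINT x:{a..b}|lborel. x * d x) = 0 \<Longrightarrow> AE x in lborel. a \<le> x \<and> x \<le> b \<longrightarrow> d x = 0"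
proof -
  define S where "S = {x. a \<le> x \<and> x < b \<and> 0 \<le> d x}"
  \<comment> \<open>Inserting \<open>a\<close> keeps the set nonempty when \<open>d\<close> is
    negative throughout; then \<open>s = a\<close>.\<close>
  define s where "s = Sup (insert a S)"
  have bdd: "bdd_above (insert a S)"
    by (rule bdd_aboveI[of _ "max a b"]) (auto simp: S_def)
  have below: "0 \<le> d x" if "a \<le> x" "x < s" for x
  proof -
    have "\<exists>y\<in>insert a S. x < y"
      using that(2) less_cSup_iff[OF _ bdd, of x] by (auto simp: s_def)
    then show ?thesis using that crossing by (auto simp: S_def)
  qed
  have above: "d x < 0" if "s < x" "x < b" for x
  proof (rule ccontr)
    assume "\<not> ?thesis"
    moreover have "a \<le> s" unfolding s_def by (rule cSup_upper[OF _ bdd]) simp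
    ultimately have "x \<in> insert a S" using that by (auto simp: S_def)
    then have "x \<le> s" unfolding s_def by (rule cSup_upper[OF _ bdd])
    then show False using that by simp
  qed
  \<comment> \<open>The crossing hypothesis says nothing about \<open>d b\<close>, so the endpoint
    is left out here and later discarded as a null set.\<close>
  have sign: "(s - x) * d x \<ge> 0" if "x \<in> {a..b}" "x \<noteq> b" for x
  proof (cases x s rule: linorder_cases)
    case less then show ?thesis using below[of x] that by simp
  next
    case greater then show ?thesis using above[of x] that by (simp add: mult_nonpos_nonpos)
  qed simp
  let ?f = "\<lambda>x. indicator {a..b} x * ((s - x) * d x)"
  have fint: "integrable lborel ?f"
  proof -
    have "set_integrable lborel {a..b} (\<lambda>x. s * d x - x * d x)"
      using int intx by (intro set_integral_diff) auto
    then show ?thesis by (simp add: set_integrable_def left_diff_distrib)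
  qed
  \<comment> \<open>The term \<open>s * d x\<close> contributes nothing because \<open>d\<close> has
    integral zero.\<close>
  have fval: "integral\<^sup>L lborel ?f = - (LINT x:{a..b}|lborel. x * d x)"
  proof -
    have "(LINT x:{a..b}|lborel. s * d x - x * d x) = - (LINT x:{a..b}|lborel. x * d x)"
      using int intx zero by (subst set_integral_diff) auto
    then show ?thesis by (simp add: set_lebesgue_integral_def left_diff_distrib)
  qed
  have fpos: "AE x in lborel. 0 \<le> ?f x"
    by (rule eventually_mono[OF AE_lborel_singleton[of b]]) (use sign in \<open>auto simp: indicator_def\<close>)
  show "(LINT x:{a..b}|lborel. x * d x) \<le> 0"
    using integral_nonneg_AE[OF fpos] fval by simp
  assume "(LINT x:{a..b}|lborel. x * d x) = 0"
  then have "AE x in lborel. ?f x = 0"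
    using integral_nonneg_eq_0_iff_AE[OF fint fpos] fval by simp
  \<comment> \<open>The factor \<open>s - x\<close> can be cancelled except at the single point
    \<open>s\<close>.\<close>
  with AE_lborel_singleton[of s]
  show "AE x in lborel. a \<le> x \<and> x \<le> b \<longrightarrow> d x = 0"
    by eventually_elim (auto simp: indicator_def)
qed

section \<open>Vertical fibres of a compact convex set\<close>

lemma fibre_length_alt: "fibre_length K x = measure lborel {y. (x, y) \<in> K}"
proof -
  have "snd ` {p \<in> K. fst p = x} = {y. (x, y) \<in> K}" by force
  then show ?thesis by (simp add: fibre_length_def)
qed

lemma fibre_length_outside: "x \<notin> fst ` K \<Longrightarrow> fibre_length K x = 0"
proof -
  assume "x \<notin> fst ` K"
  then have "{y. (x, y) \<in> K} = {}" by force
  then show ?thesis by (simp add: fibre_length_alt)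
qed

text \<open>Over an empty fibre the supremum carries no meaning; there it only enters integrals
  multiplied by the fibre length, which is zero.\<close>

definition fibre_top :: "(real \<times> real) set \<Rightarrow> real \<Rightarrow> real" where
  "fibre_top K x = Sup {y. (x, y) \<in> K}"

text \<open>The fibre is the second projection of a compact convex slice of \<open>K\<close>, hence
  a closed bounded interval. Its lower end is written as top minus length, so two functions describe
  the whole fibre.\<close>

lemma fibre_interval:
  assumes "compact K" "convex K" "x \<in> fst ` K"
  shows "{y. (x, y) \<in> K} = {fibre_top K x - fibre_length K x..fibre_top K x}"
    and "0 \<le> fibre_length K x"
proof -
  have eq: "{y. (x, y) \<in> K} = snd ` (K \<inter> {x} \<times> UNIV)" by force
  have "compact (K \<inter> {x} \<times> UNIV)"
    by (intro compact_Int_closed assms closed_Times) auto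
  then have "compact {y. (x, y) \<in> K}"
    unfolding eq by (intro compact_continuous_image continuous_on_snd continuous_on_id)
  moreover have "convex {y. (x, y) \<in> K}"
    unfolding eq by (intro convex_linear_image[OF linear_snd] convex_Int assms convex_Times) auto
  ultimately obtain a b where ab: "{y. (x, y) \<in> K} = {a..b}"
    using connected_compact_interval_1[THEN iffD1] convex_connected by (metis (no_types))
  have "{y. (x, y) \<in> K} \<noteq> {}" using assms(3) by force
  then have "a \<le> b" using ab by simp
  then show "{y. (x, y) \<in> K} = {fibre_top K x - fibre_length K x..fibre_top K x}"
    and "0 \<le> fibre_length K x"
    by (simp_all add: fibre_length_alt fibre_top_def ab)
qed

lemma fibre_endpoints:
  assumes "compact K" "convex K" "x \<in> fst ` K"
  shows "(x, fibre_top K x) \<in> K" and "(x, fibre_top K x - fibre_length K x) \<in> K"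
    and "\<And>y. (x, y) \<in> K \<Longrightarrow> y \<le> fibre_top K x"
    and "\<And>y. (x, y) \<in> K \<Longrightarrow> fibre_top K x - fibre_length K x \<le> y"
proof -
  have mem: "(x, y) \<in> K \<longleftrightarrow> fibre_top K x - fibre_length K x \<le> y \<and> y \<le> fibre_top K x" for y
    using arg_cong[OF fibre_interval(1)[OF assms], of "\<lambda>S. y \<in> S"]
    by (simp only: mem_Collect_eq atLeastAtMost_iff)
  show "(x, fibre_top K x) \<in> K" "(x, fibre_top K x - fibre_length K x) \<in> K"
    "\<And>y. (x, y) \<in> K \<Longrightarrow> y \<le> fibre_top K x"
    "\<And>y. (x, y) \<in> K \<Longrightarrow> fibre_top K x - fibre_length K x \<le> y"
    using fibre_interval(2)[OF assms] by (simp_all add: mem)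
qed

text \<open>The same convex combination of the two upper endpoints and of the two lower endpoints
  lies in \<open>K\<close>; the fibre containing both is at least as long as their distance.\<close>

lemma fibre_length_concave:
  assumes K: "compact K" "convex K" and x: "x \<in> fst ` K" and z: "z \<in> fst ` K"
    and uv: "0 \<le> u" "0 \<le> v" "u + v = 1"
  shows "u * fibre_length K x + v * fibre_length K z \<le> fibre_length K (u * x + v * z)"
proof -
  note ex = fibre_endpoints[OF K x] and ez = fibre_endpoints[OF K z]
  let ?w = "u * x + v * z"
  have top: "(?w, u * fibre_top K x + v * fibre_top K z) \<in> K"
    using convexD[OF K(2) ex(1) ez(1) uv] by simp
  have bot: "(?w, u * (fibre_top K x - fibre_length K x) + v * (fibre_top K z - fibre_length K z)) \<in> K"
    using convexD[OF K(2) ex(2) ez(2) uv] by simp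
  have "?w \<in> fst ` K" using top by force
  from fibre_endpoints(3)[OF K this top] fibre_endpoints(4)[OF K this bot] show ?thesis
    by (simp add: algebra_simps)
qed

lemma fibre_length_three_points:
  assumes K: "compact K" "convex K" and x: "x \<in> fst ` K" and z: "z \<in> fst ` K"
    and "x \<le> y" "y \<le> z"
  shows "(z - y) * fibre_length K x + (y - x) * fibre_length K z \<le> (z - x) * fibre_length K y"
proof (cases "x = z")
  case False
  with assms have lt: "x < z" by simp
  let ?u = "(z - y) / (z - x)" and ?v = "(y - x) / (z - x)"
  have "?u + ?v = 1" using lt by (simp add: divide_simps)
  moreover have "?u * x + ?v * z = y" using lt by (simp add: divide_simps) (simp add: algebra_simps)
  ultimately have "?u * fibre_length K x + ?v * fibre_length K z \<le> fibre_length K y"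
    using fibre_length_concave[OF K x z, of ?u ?v] assms lt by simp
  then have "(z - x) * (?u * fibre_length K x + ?v * fibre_length K z) \<le> (z - x) * fibre_length K y"
    using lt by simp
  moreover have "(z - x) * (?u * fibre_length K x + ?v * fibre_length K z) =
      (z - y) * fibre_length K x + (y - x) * fibre_length K z"
    using lt by (simp add: distrib_left)
  ultimately show ?thesis by simp
qed (use assms in auto)

section \<open>Integration along fibres\<close>

lemma compact_Fubini:
  fixes f :: "real \<times> real \<Rightarrow> real"
  assumes "compact K" "continuous_on K f"
  shows "integrable lborel (\<lambda>x. LINT y:{y. (x, y) \<in> K}|lborel. f (x, y))"
    and "(LINT p:K|lborel. f p) = (\<integral>x. (LINT y:{y. (x, y) \<in> K}|lborel. f (x, y)) \<partial>lborel)"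
proof -
  have "integrable (lborel \<Otimes>\<^sub>M lborel) (\<lambda>p. indicator K p *\<^sub>R f p)"
    using borel_integrable_compact[OF assms] by (simp add: lborel_prod)
  from lborel_pair.integrable_fst'[OF this] lborel_pair.integral_fst'[OF this]
  show "integrable lborel (\<lambda>x. LINT y:{y. (x, y) \<in> K}|lborel. f (x, y))"
    and "(LINT p:K|lborel. f p) = (\<integral>x. (LINT y:{y. (x, y) \<in> K}|lborel. f (x, y)) \<partial>lborel)"
    by (simp_all add: set_lebesgue_integral_def indicator_def lborel_prod)
qed

text \<open>The integrand is constant along each fibre. The weights \<open>1\<close> and
  \<open>x\<close> give the volume and the integral of the first coordinate.\<close>

lemma fibre_integral_fst:
  fixes w :: "real \<Rightarrow> real"
  assumes K: "compact K" "convex K" and w: "continuous_on UNIV w"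
  shows "integrable lborel (\<lambda>x. w x * fibre_length K x)"
    and "(LINT p:K|lborel. w (fst p)) = (\<integral>x. w x * fibre_length K x \<partial>lborel)"
proof -
  have eq: "(LINT y:{y. (x, y) \<in> K}|lborel. w (fst (x, y))) = w x * fibre_length K x" for x
  proof (cases "x \<in> fst ` K")
    case True
    show ?thesis unfolding fibre_interval(1)[OF K True]
      using set_integral_quadratic[of "fibre_top K x - fibre_length K x" "fibre_top K x" "w x" 0 0]
        fibre_interval(2)[OF K True] by simp
  next
    case False
    then have "{y. (x, y) \<in> K} = {}" by force
    then show ?thesis using False by (simp add: fibre_length_outside set_lebesgue_integral_def)
  qed
  have "continuous_on K (\<lambda>p. w (fst p))"
    by (intro continuous_on_compose2[OF w] continuous_intros) auto
  from compact_Fubini[OF K(1) this, unfolded eq]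
  show "integrable lborel (\<lambda>x. w x * fibre_length K x)"
    and "(LINT p:K|lborel. w (fst p)) = (\<integral>x. w x * fibre_length K x \<partial>lborel)" .
qed

text \<open>Length times height of the midpoint: the integral of the second coordinate along the
  fibre.\<close>

definition fibre_moment :: "(real \<times> real) set \<Rightarrow> real \<Rightarrow> real" where
  "fibre_moment K x = fibre_length K x * (fibre_top K x - fibre_length K x / 2)"

lemma fibre_integral_snd:
  assumes K: "compact K" "convex K"
  shows "integrable lborel (fibre_moment K)"
    and "(LINT p:K|lborel. snd p) = (\<integral>x. fibre_moment K x \<partial>lborel)"
proof -
  have eq: "(LINT y:{y. (x, y) \<in> K}|lborel. snd (x, y)) = fibre_moment K x" for x
  proof (cases "x \<in> fst ` K")
    case True
    show ?thesis unfolding fibre_interval(1)[OF K True]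
      using set_integral_quadratic[of "fibre_top K x - fibre_length K x" "fibre_top K x" 0 1 0]
        fibre_interval(2)[OF K True]
      by (simp add: fibre_moment_def power2_eq_square field_simps)
  next
    case False
    then have "{y. (x, y) \<in> K} = {}" by force
    then show ?thesis using False
      by (simp add: fibre_moment_def fibre_length_outside set_lebesgue_integral_def)
  qed
  have "continuous_on K (snd :: real \<times> real \<Rightarrow> real)" by (intro continuous_intros)
  from compact_Fubini[OF K(1) this, unfolded eq]
  show "integrable lborel (fibre_moment K)"
    and "(LINT p:K|lborel. snd p) = (\<integral>x. fibre_moment K x \<partial>lborel)" .
qed

text \<open>If the barycenter were outside, a hyperplane would strictly separate it from
  \<open>K\<close>; averaging the separating linear form over \<open>K\<close> gives its value at
  the barycenter, a contradiction.\<close>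

lemma barycenter_in:
  assumes K: "compact K" "convex K" and pos: "0 < measure lborel K"
  shows "barycenter K \<in> K"
proof (rule ccontr)
  assume "barycenter K \<notin> K"
  with separating_hyperplane_closed_point[OF K(2) compact_imp_closed[OF K(1)]]
  obtain a c where ac: "a \<bullet> barycenter K < c" "\<And>p. p \<in> K \<Longrightarrow> c < a \<bullet> p" by blast
  have int: "set_integrable lborel K f" if "continuous_on K f" for f :: "real \<times> real \<Rightarrow> real"
    using borel_integrable_compact[OF K(1) that] by (simp add: set_integrable_def)
  have "c * measure lborel K = (LINT p:K|lborel. c)"
    by (simp add: set_lebesgue_integral_def)
  also have "\<dots> \<le> (LINT p:K|lborel. fst a * fst p + snd a * snd p)"
    by (intro set_integral_mono int continuous_intros)
      (use ac(2) in \<open>auto simp: inner_prod_def intro: less_imp_le\<close>)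
  also have "\<dots> = fst a * (LINT p:K|lborel. fst p) + snd a * (LINT p:K|lborel. snd p)"
    by (subst set_integral_add) (auto intro!: int continuous_intros)
  also have "\<dots> = measure lborel K * (a \<bullet> barycenter K)"
    using pos by (simp add: barycenter_def inner_prod_def distrib_left)
  finally show False using ac(1) pos by (simp add: mult.commute)
qed

section \<open>Splitting integrals and segments in convex sets\<close>

lemma integral_split:
  fixes f :: "real \<Rightarrow> real"
  assumes f: "integrable lborel f" and ab: "a \<le> c" "c \<le> b"
    and out: "\<And>x. x \<notin> {a..b} \<Longrightarrow> f x = 0"
  shows "integral\<^sup>L lborel f = (LINT x:{a..c}|lborel. f x) + (LINT x:{c..b}|lborel. f x)"
proof -
  have int: "set_integrable lborel A f" if "A \<in> sets lborel" for A
    using integrable_mult_indicator[OF that f] by (simp add: set_integrable_def)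
  have "integral\<^sup>L lborel f = (LINT x:{a..c} \<union> {c..b}|lborel. f x)"
    unfolding set_lebesgue_integral_def using ab out
    by (intro Bochner_Integration.integral_cong) (auto simp: indicator_def)
  also have "\<dots> = (LINT x:{a..c}|lborel. f x) + (LINT x:{c..b}|lborel. f x)"
  proof (intro set_integral_Un_AE int)
    show "AE x in lborel. \<not> (x \<in> {a..c} \<and> x \<in> {c..b})"
      by (rule eventually_mono[OF AE_lborel_singleton[of c]]) auto
  qed auto
  finally show ?thesis .
qed

text \<open>The equation for \<open>y\<close> is linear interpolation between \<open>p\<close> and
  \<open>q\<close> with denominators cleared, so applications reduce to polynomial
  identities.\<close>

lemma convex_segment_graph:
  fixes H :: "(real \<times> real) set"
  assumes H: "convex H" "(a, p) \<in> H" "(b, q) \<in> H" and x: "a \<le> x" "x \<le> b" and "a < b"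
    and y: "(b - a) * y = (b - x) * p + (x - a) * q"
  shows "(x, y) \<in> H"
proof -
  let ?u = "(b - x) / (b - a)" and ?v = "(x - a) / (b - a)"
  have "?u + ?v = (b - x + (x - a)) / (b - a)" by (simp only: add_divide_distrib)
  then have "?u + ?v = 1" using \<open>a < b\<close> by simp
  moreover have "(b - x) * a + (x - a) * b = (b - a) * x" by (simp add: algebra_simps)
  then have "((b - x) * a + (x - a) * b) / (b - a) = x" using \<open>a < b\<close> by simp
  then have "?u * a + ?v * b = x" by (simp add: add_divide_distrib)
  moreover have "?u * p + ?v * q = ((b - x) * p + (x - a) * q) / (b - a)"
    by (simp add: add_divide_distrib)
  then have "?u * p + ?v * q = y" using \<open>a < b\<close> by (simp add: y[symmetric])
  ultimately show ?thesis
    using convexD[OF H, of ?u ?v] x \<open>a < b\<close> by simp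
qed

lemma convex_vertical:
  fixes H :: "(real \<times> real) set"
  assumes "convex H" "(x, p) \<in> H" "(x, q) \<in> H" "p \<le> y" "y \<le> q"
  shows "(x, y) \<in> H"
proof -
  \<comment> \<open>After swapping coordinates the vertical segment is the graph of a constant
    function.\<close>
  have "convex (prod.swap ` H)"
    by (rule convex_linear_image[OF _ assms(1)])
      (auto intro!: linearI)
  moreover have "(p, x) \<in> prod.swap ` H" "(q, x) \<in> prod.swap ` H" using assms by force+
  ultimately have "(y, x) \<in> prod.swap ` H" if "p < q"
    using convex_segment_graph[of "prod.swap ` H" p x q x y x] that assms
    by (simp add: algebra_simps)
  moreover have "y = p" if "\<not> p < q" using that assms(4,5) by simp
  ultimately show ?thesis using assms(2) by (cases "p < q") auto
qed

lemma set_integral_point: "(LINT x:{c..c}|lborel. f x) = (0::real)" for c :: real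
  unfolding set_lebesgue_integral_def
  by (rule integral_eq_zero_AE, rule eventually_mono[OF AE_lborel_singleton[of c]]) auto

section \<open>Convex bodies with a prescribed left trapezoid\<close>

locale trapezoid_body =
  fixes V c0 c1 c2 :: real and K :: "(real \<times> real) set"
  assumes V_pos: "V > 0" and c1_pos: "c1 > 0" and c2_pos: "c2 > 0"
    and c0_nonneg: "c0 \<ge> 0" and c0_le_c2: "c0 \<le> c2"
    and K_compact: "compact K" and K_convex: "convex K"
    and K_vol: "measure lborel K = V"
    and K_left: "K \<inter> {(x1, x2). x1 \<le> c1} =
      {(x1, x2). 0 \<le> x1 \<and> x1 \<le> c1 \<and> 0 \<le> x2 \<and> x2 \<le> (c2 - c0) / c1 * x1 + c0}"
begin

definition slope :: real where "slope = (c2 - c0) / c1"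

definition roof :: "real \<Rightarrow> real" where "roof x = slope * x + c0"

text \<open>The number \<open>t1\<close> of the theorem.\<close>

definition right_end :: real where "right_end = Sup (fst ` K)"

text \<open>The right end at which the trapezoid and a region with fibre lengths falling linearly
  from \<open>c2\<close> to \<open>0\<close> have total area \<open>V\<close>: solve
  \<open>c1 * (c0 + c2) / 2 + c2 * (apex - c1) / 2 = V\<close>.\<close>

definition apex :: real where "apex = (2 * V - c0 * c1) / c2"

lemma slope_nonneg: "0 \<le> slope"
  using c1_pos c0_le_c2 by (simp add: slope_def)

lemma slope_c1: "slope * c1 = c2 - c0"
  using c1_pos by (simp add: slope_def)

lemma roof_c1: "roof c1 = c2"
  by (simp add: roof_def slope_c1)

lemma roof_nonneg: "0 \<le> x \<Longrightarrow> 0 \<le> roof x"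
  using slope_nonneg c0_nonneg by (simp add: roof_def)

lemma c2_apex: "c2 * apex = 2 * V - c0 * c1"
  using c2_pos by (simp add: apex_def)

lemma left_iff: "x \<le> c1 \<Longrightarrow> (x, y) \<in> K \<longleftrightarrow> 0 \<le> x \<and> 0 \<le> y \<and> y \<le> roof x"
  using arg_cong[OF K_left, of "\<lambda>S. (x, y) \<in> S"] by (auto simp only: Int_iff mem_Collect_eq prod.case roof_def slope_def)

lemma fst_image: "fst ` K = {0..right_end}"
  and c1_le_right_end: "c1 \<le> right_end"
proof -
  have "compact (fst ` K)"
    by (rule compact_continuous_image[OF continuous_on_fst[OF continuous_on_id] K_compact])
  moreover have "convex (fst ` K)"
    by (rule convex_linear_image[OF linear_fst K_convex])
  ultimately obtain a b where ab: "fst ` K = {a..b}"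
    using connected_compact_interval_1[THEN iffD1] convex_connected by (metis (no_types))
  have "(0, 0) \<in> K" "(c1, 0) \<in> K"
    using left_iff[of 0 0] left_iff[of c1 0] c1_pos roof_nonneg by auto
  then have "0 \<in> {a..b}" "c1 \<in> {a..b}" unfolding ab[symmetric] by force+
  moreover have "a = 0"
  proof (rule ccontr)
    assume "a \<noteq> 0"
    with \<open>0 \<in> {a..b}\<close> have "a \<in> fst ` K" "a < 0" by (auto simp: ab)
    then show False using left_iff[of a] c1_pos by auto
  qed
  ultimately show "fst ` K = {0..right_end}" "c1 \<le> right_end"
    by (auto simp: ab right_end_def)
qed

text \<open>For \<open>x > c1\<close>, join \<open>(x, y)\<close> to \<open>(0, 0)\<close> and to
  \<open>(0, c0)\<close>. Both segments cross the line at \<open>c1\<close>, where the fibre is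
  known; the first gives the lower bound, the second the upper one.\<close>

lemma below_roof:
  assumes "(x, y) \<in> K"
  shows "0 \<le> y" and "y \<le> roof x"
proof -
  have "0 \<le> y \<and> y \<le> roof x"
  proof (cases "x \<le> c1")
    case False
    let ?u = "1 - c1 / x" and ?v = "c1 / x"
    have uv: "0 \<le> ?u" "0 \<le> ?v" "?u + ?v = 1" using False c1_pos by auto
    have pts: "(0, 0) \<in> K" "(0, c0) \<in> K"
      using left_iff[of 0] c1_pos c0_nonneg by (auto simp: roof_def)
    have x: "?v * x = c1" using False c1_pos by simp
    have "(c1, ?v * y) \<in> K"
      using convexD[OF K_convex pts(1) assms uv] x by simp
    then have "0 \<le> ?v * y" using left_iff by blast
    then have "0 \<le> y" using False c1_pos by (simp add: zero_le_mult_iff zero_le_divide_iff)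
    have "(c1, ?u * c0 + ?v * y) \<in> K"
      using convexD[OF K_convex pts(2) assms uv] x by simp
    then have "?u * c0 + ?v * y \<le> c2" using left_iff roof_c1 by auto
    then have "c1 * y \<le> c0 * c1 + (c2 - c0) * x" using False c1_pos by (simp add: field_simps)
    then have "c1 * y \<le> c1 * (slope * x + c0)" by (simp add: slope_c1[symmetric] algebra_simps)
    then show ?thesis using \<open>0 \<le> y\<close> c1_pos by (simp add: roof_def)
  qed (use assms left_iff in auto)
  then show "0 \<le> y" "y \<le> roof x" by auto
qed

lemma fibre_left:
  assumes "0 \<le> x" "x \<le> c1"
  shows "fibre_length K x = roof x" and "fibre_top K x = roof x"
proof -
  have "{y. (x, y) \<in> K} = {0..roof x}"
    by (rule set_eqI) (simp only: mem_Collect_eq left_iff[OF assms(2)] assms(1) atLeastAtMost_iff simp_thms)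
  then show "fibre_length K x = roof x" "fibre_top K x = roof x"
    using roof_nonneg[OF assms(1)] by (simp_all add: fibre_length_alt fibre_top_def)
qed

lemma fibre_length_c1: "fibre_length K c1 = c2"
  using fibre_left[of c1] c1_pos roof_c1 by simp

lemma fibre_length_nonneg: "0 \<le> fibre_length K x"
  by (simp add: fibre_length_def)

lemma fibre_length_right: "right_end < x \<Longrightarrow> fibre_length K x = 0"
  by (simp add: fibre_length_outside fst_image)

lemma fibre_top_le_roof: "x \<in> {0..right_end} \<Longrightarrow> fibre_top K x \<le> roof x"
  using fibre_endpoints(1)[OF K_compact K_convex] below_roof(2) by (simp add: fst_image)

lemma fibre_moment_left: "0 \<le> x \<Longrightarrow> x \<le> c1 \<Longrightarrow> fibre_moment K x = (roof x)\<^sup>2 / 2"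
  by (simp add: fibre_moment_def fibre_left power2_eq_square)

text \<open>Left of \<open>c1\<close> everything is explicit. The bound \<open>B\<close> is free so
  that the same formulas serve for \<open>right_end\<close>, for \<open>apex\<close> and, when
  nothing lies further right, for \<open>c1\<close>.\<close>

lemma integrals_split:
  assumes B: "right_end \<le> B"
  shows volume_split: "V = c1 * (c0 + c2) / 2 + (LINT x:{c1..B}|lborel. fibre_length K x)"
    and fst_split: "(LINT p:K|lborel. fst p) =
      (c0 + 2 * c2) * c1\<^sup>2 / 6 + (LINT x:{c1..B}|lborel. x * fibre_length K x)"
    and snd_split: "(LINT p:K|lborel. snd p) =
      c1 * (c0\<^sup>2 + c0 * c2 + c2\<^sup>2) / 6 + (LINT x:{c1..B}|lborel. fibre_moment K x)"
proof -
  note Kcc = K_compact K_convex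
  have cB: "0 \<le> c1" "c1 \<le> B" using c1_pos c1_le_right_end B by auto
  have out: "fibre_length K x = 0" if "x \<notin> {0..B}" for x
    using that B by (intro fibre_length_outside) (auto simp: fst_image)
  have outm: "fibre_moment K x = 0" if "x \<notin> {0..B}" for x
    by (simp add: fibre_moment_def out[OF that])
  note f0 = fibre_integral_fst[OF Kcc, of "\<lambda>_. 1", simplified]
  note f1 = fibre_integral_fst[OF Kcc, of "\<lambda>x. x", simplified]
  note f2 = fibre_integral_snd[OF Kcc]
  \<comment> \<open>With the slope as a variable and \<open>c2\<close> eliminated, the evaluations
    become identities without division by \<open>c1\<close>.\<close>
  obtain m where m: "\<And>x. roof x = m * x + c0" and s: "c2 = m * c1 + c0"
    using roof_c1 roof_def by metis
  have q0: "(LINT x:{0..c1}|lborel. fibre_length K x) = c1 * (c0 + c2) / 2"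
  proof -
    have "(LINT x:{0..c1}|lborel. fibre_length K x) = (LINT x:{0..c1}|lborel. c0 + m * x + 0 * x\<^sup>2)"
      by (intro set_lebesgue_integral_cong) (auto simp: fibre_left m)
    then show ?thesis using cB by (subst (asm) set_integral_quadratic) (auto simp: s power2_eq_square field_simps)
  qed
  have q1: "(LINT x:{0..c1}|lborel. x * fibre_length K x) = (c0 + 2 * c2) * c1\<^sup>2 / 6"
  proof -
    have "(LINT x:{0..c1}|lborel. x * fibre_length K x) = (LINT x:{0..c1}|lborel. 0 + c0 * x + m * x\<^sup>2)"
      by (intro set_lebesgue_integral_cong) (auto simp: fibre_left m power2_eq_square algebra_simps)
    then show ?thesis using cB by (subst (asm) set_integral_quadratic) (auto simp: s power2_eq_square power3_eq_cube field_simps)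
  qed
  have q2: "(LINT x:{0..c1}|lborel. fibre_moment K x) = c1 * (c0\<^sup>2 + c0 * c2 + c2\<^sup>2) / 6"
  proof -
    have "(LINT x:{0..c1}|lborel. fibre_moment K x) =
        (LINT x:{0..c1}|lborel. c0\<^sup>2 / 2 + (c0 * m) * x + (m\<^sup>2 / 2) * x\<^sup>2)"
      by (intro set_lebesgue_integral_cong)
        (auto simp: fibre_moment_left m power2_eq_square field_simps)
    then show ?thesis using cB by (subst (asm) set_integral_quadratic) (auto simp: s power2_eq_square power3_eq_cube field_simps)
  qed
  have "V = (LINT p:K|lborel. 1)" using K_vol by (simp add: set_lebesgue_integral_def)
  also have "\<dots> = c1 * (c0 + c2) / 2 + (LINT x:{c1..B}|lborel. fibre_length K x)"
    unfolding f0(2)[symmetric] using integral_split[OF f0(1) cB out] f0(2) q0 by simp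
  finally show "V = c1 * (c0 + c2) / 2 + (LINT x:{c1..B}|lborel. fibre_length K x)" .
  show "(LINT p:K|lborel. fst p) =
      (c0 + 2 * c2) * c1\<^sup>2 / 6 + (LINT x:{c1..B}|lborel. x * fibre_length K x)"
    using integral_split[OF f1(1) cB] out f1(2) q1 by simp
  show "(LINT p:K|lborel. snd p) =
      c1 * (c0\<^sup>2 + c0 * c2 + c2\<^sup>2) / 6 + (LINT x:{c1..B}|lborel. fibre_moment K x)"
    using integral_split[OF f2(1) cB outm] f2(2) q2 by simp
qed

lemma integrable_on:
  assumes "A \<in> sets lborel"
  shows fibre_length_integrable: "set_integrable lborel A (fibre_length K)"
    and fibre_length_integrable_fst: "set_integrable lborel A (\<lambda>x. x * fibre_length K x)"
    and fibre_moment_integrable: "set_integrable lborel A (fibre_moment K)"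
proof -
  note f0 = fibre_integral_fst(1)[OF K_compact K_convex, of "\<lambda>_. 1", simplified]
  note f1 = fibre_integral_fst(1)[OF K_compact K_convex, of "\<lambda>x. x", simplified]
  note f2 = fibre_integral_snd(1)[OF K_compact K_convex]
  show "set_integrable lborel A (fibre_length K)"
    unfolding set_integrable_def by (rule integrable_mult_indicator[OF assms f0])
  show "set_integrable lborel A (\<lambda>x. x * fibre_length K x)"
    unfolding set_integrable_def by (rule integrable_mult_indicator[OF assms f1])
  show "set_integrable lborel A (fibre_moment K)"
    unfolding set_integrable_def by (rule integrable_mult_indicator[OF assms f2])
qed

text \<open>By concavity the fibre length on \<open>{c1..right_end}\<close> dominates the affine
  function falling from \<open>c2\<close> to \<open>0\<close>. Its area
  \<open>c2 * (right_end - c1) / 2\<close> is thus at most the remaining volume, which is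
  \<open>c2 * (apex - c1) / 2\<close>.\<close>

lemma right_end_le_apex: "right_end \<le> apex"
proof (cases "right_end = c1")
  case True
  have "V = c1 * (c0 + c2) / 2 + (LINT x:{c1..c1}|lborel. fibre_length K x)"
    using volume_split[of c1] True by simp
  also have "(LINT x:{c1..c1}|lborel. fibre_length K x) = 0"
    by (rule set_integral_point)
  finally have "c2 * apex = c2 * c1" unfolding c2_apex by (simp add: algebra_simps)
  then show ?thesis using True c2_pos by simp
next
  case False
  then have lt: "c1 < right_end" using c1_le_right_end by simp
  let ?w = "right_end - c1"
  obtain k where k: "c2 = k * ?w" using lt that[of "c2 / ?w"] by simp
  have "c2 * ?w / 2 = (LINT x:{c1..right_end}|lborel. k * right_end + (- k) * x + 0 * x\<^sup>2)"
    unfolding k using lt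
    by (subst set_integral_quadratic) (auto simp: power2_eq_square field_simps)
  also have "\<dots> \<le> (LINT x:{c1..right_end}|lborel. fibre_length K x)"
  proof (rule set_integral_mono)
    show "set_integrable lborel {c1..right_end} (\<lambda>x. k * right_end + (- k) * x + 0 * x\<^sup>2)"
      by (intro set_integral_Icc_cont continuous_intros)
    show "set_integrable lborel {c1..right_end} (fibre_length K)"
      by (rule fibre_length_integrable) simp
    fix x assume x: "x \<in> {c1..right_end}"
    have "(right_end - x) * c2 + (x - c1) * fibre_length K right_end \<le> ?w * fibre_length K x"
      using fibre_length_three_points[OF K_compact K_convex, of c1 right_end x]
        x lt c1_pos fst_image fibre_length_c1 by simp
    \<comment> \<open>The fibre over \<open>right_end\<close> may have positive length; only its
      sign is used.\<close>
    moreover have "0 \<le> (x - c1) * fibre_length K right_end" using x fibre_length_nonneg by simp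
    ultimately have "?w * (k * (right_end - x)) \<le> ?w * fibre_length K x"
      using k by (simp add: mult.commute mult.left_commute)
    then have "k * (right_end - x) \<le> fibre_length K x" using lt by simp
    then show "k * right_end + (- k) * x + 0 * x\<^sup>2 \<le> fibre_length K x"
      by (simp add: algebra_simps)
  qed
  finally have "c2 * right_end \<le> c2 * apex"
    unfolding c2_apex using volume_split[OF order_refl] by (simp add: field_simps)
  then show ?thesis using c2_pos by simp
qed

lemma c1_le_apex: "c1 \<le> apex"
  using c1_le_right_end right_end_le_apex by simp

section \<open>Comparison of the fibre length with the extremal one\<close>

text \<open>The fibre length of the extremal body right of \<open>c1\<close>. If
  \<open>apex = c1\<close>, division by zero makes it vanish, so facts about its slope assume
  \<open>c1 < apex\<close>.\<close>

definition edge :: "real \<Rightarrow> real" where "edge x = c2 * ((apex - x) / (apex - c1))"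

definition excess :: "real \<Rightarrow> real" where "excess x = fibre_length K x - edge x"

text \<open>The integrals of the coordinates over the extremal convex hull.\<close>
definition max_fst :: real where
  "max_fst = (c0 * c1\<^sup>2 + c1 * c2 * apex + c2 * apex\<^sup>2) / 6"

definition max_snd :: real where
  "max_snd = ((c0 * c1 + c2 * apex)\<^sup>2 - c0 * c2 * apex\<^sup>2) / (6 * c1)"

lemma edge_line:
  assumes "c1 < apex"
  obtains k where "0 < k" "c2 = k * (apex - c1)" "\<And>x. edge x = k * (apex - x)"
proof
  show "0 < c2 / (apex - c1)" using assms c2_pos by simp
  show "c2 = c2 / (apex - c1) * (apex - c1)" using assms by simp
  show "edge x = c2 / (apex - c1) * (apex - x)" for x by (simp add: edge_def)
qed

lemma roof_line:
  obtains m where "0 \<le> m" "c2 = m * c1 + c0" "\<And>x. roof x = m * x + c0"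
  using that[of slope] slope_nonneg slope_c1 roof_def by auto

text \<open>Since \<open>edge\<close> is affine and agrees with the fibre length at
  \<open>c1\<close>, concavity says that \<open>excess x / (x - c1)\<close> does not
  increase.\<close>

lemma excess_three_points:
  assumes "c1 < apex" "c1 \<le> x" "x \<le> y" "y \<le> right_end"
  shows "(x - c1) * excess y \<le> (y - c1) * excess x"
proof -
  obtain k where k: "c2 = k * (apex - c1)" "\<And>x. edge x = k * (apex - x)"
    using edge_line[OF assms(1)] by metis
  have "(y - x) * c2 + (x - c1) * fibre_length K y \<le> (y - c1) * fibre_length K x"
    using fibre_length_three_points[OF K_compact K_convex, of c1 y x] assms c1_pos fst_image
      fibre_length_c1 by simp
  moreover have "(y - x) * c2 + (x - c1) * edge y = (y - c1) * edge x"
    unfolding k(2) by (subst k(1)) (simp add: algebra_simps)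
  ultimately show ?thesis by (simp add: excess_def right_diff_distrib)
qed

lemma edge_continuous: "continuous_on A edge"
proof -
  have "continuous_on A (\<lambda>x. k * (apex - x))" for k by (intro continuous_intros)
  from this[of "c2 / (apex - c1)"] show ?thesis by (simp add: edge_def[abs_def])
qed

lemma excess_integrable:
  "set_integrable lborel {c1..apex} excess"
  "set_integrable lborel {c1..apex} (\<lambda>x. x * excess x)"
proof -
  have "set_integrable lborel {c1..apex} (\<lambda>x. fibre_length K x - edge x)"
    by (intro set_integral_diff fibre_length_integrable set_integral_Icc_cont edge_continuous) auto
  then show "set_integrable lborel {c1..apex} excess" by (simp add: excess_def[abs_def])
  have "set_integrable lborel {c1..apex} (\<lambda>x. x * fibre_length K x - x * edge x)"
    by (intro set_integral_diff fibre_length_integrable_fst set_integral_Icc_cont edge_continuous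
        continuous_on_mult continuous_on_id) auto
  then show "set_integrable lborel {c1..apex} (\<lambda>x. x * excess x)"
    by (simp add: excess_def[abs_def] right_diff_distrib)
qed

text \<open>The first integral vanishes by the choice of \<open>apex\<close>, which equalizes the
  areas. In the second, the trapezoid is common to \<open>K\<close> and the extremal body and
  cancels.\<close>

lemma excess_integrals:
  assumes lt: "c1 < apex"
  shows "(LINT x:{c1..apex}|lborel. excess x) = 0"
    and "(LINT x:{c1..apex}|lborel. x * excess x) = (LINT p:K|lborel. fst p) - max_fst"
proof -
  obtain k where k: "c2 = k * (apex - c1)" "\<And>x. edge x = k * (apex - x)"
    using edge_line[OF lt] by metis
  have e0: "(LINT x:{c1..apex}|lborel. edge x) = c2 * (apex - c1) / 2"
  proof -
    have "(LINT x:{c1..apex}|lborel. edge x) = (LINT x:{c1..apex}|lborel. k * apex + (- k) * x + 0 * x\<^sup>2)"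
      by (intro set_lebesgue_integral_cong) (auto simp: k(2) algebra_simps)
    also have "\<dots> = k * (apex - c1) * (apex - c1) / 2"
      using lt by (subst set_integral_quadratic) (auto simp: power2_eq_square field_simps)
    finally show ?thesis using k(1) by simp
  qed
  have e1: "(LINT x:{c1..apex}|lborel. x * edge x) = c2 * (apex - c1) * (2 * c1 + apex) / 6"
  proof -
    have "(LINT x:{c1..apex}|lborel. x * edge x) = (LINT x:{c1..apex}|lborel. 0 + k * apex * x + (- k) * x\<^sup>2)"
      by (intro set_lebesgue_integral_cong) (auto simp: k(2) power2_eq_square algebra_simps)
    also have "\<dots> = k * (apex - c1) * (apex - c1) * (2 * c1 + apex) / 6"
      using lt by (subst set_integral_quadratic) (auto simp: power2_eq_square power3_eq_cube field_simps)
    finally show ?thesis using k(1) by simp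
  qed
  note int = fibre_length_integrable fibre_length_integrable_fst set_integral_Icc_cont edge_continuous
  have "(LINT x:{c1..apex}|lborel. fibre_length K x - edge x) =
      (LINT x:{c1..apex}|lborel. fibre_length K x) - c2 * (apex - c1) / 2"
    unfolding e0[symmetric] by (intro set_integral_diff int continuous_on_mult continuous_on_id) simp_all
  then show "(LINT x:{c1..apex}|lborel. excess x) = 0"
    using volume_split[OF right_end_le_apex] c2_apex by (simp add: excess_def field_simps)
  have "(LINT x:{c1..apex}|lborel. x * fibre_length K x - x * edge x) =
      (LINT x:{c1..apex}|lborel. x * fibre_length K x) - c2 * (apex - c1) * (2 * c1 + apex) / 6"
    unfolding e1[symmetric] by (intro set_integral_diff int continuous_on_mult continuous_on_id) simp_all
  then show "(LINT x:{c1..apex}|lborel. x * excess x) = (LINT p:K|lborel. fst p) - max_fst"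
    using fst_split[OF right_end_le_apex]
    by (simp add: excess_def max_fst_def right_diff_distrib power2_eq_square field_simps)
qed

text \<open>Before \<open>apex\<close> the function \<open>edge\<close> is positive, so a
  nonnegative excess at \<open>y\<close> forces a nonempty fibre there; then
  \<open>excess_three_points\<close> applies.\<close>

lemma excess_crossing:
  assumes "c1 < apex" "c1 \<le> x" "x < y" "y < apex" "0 \<le> excess y"
  shows "0 \<le> excess x"
proof -
  obtain k where k: "0 < k" "\<And>x. edge x = k * (apex - x)" using edge_line[OF assms(1)] by metis
  have "0 < edge y" using assms k by simp
  then have "y \<le> right_end" using assms(5) fibre_length_right[of y] by (force simp: excess_def)
  then have "0 \<le> (y - c1) * excess x"
    using excess_three_points[of x y] assms by (smt (verit) mult_nonneg_nonneg)
  then show ?thesis using assms by (simp add: zero_le_mult_iff)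
qed

text \<open>The case in which \<open>K\<close> is the trapezoid itself.\<close>

lemma degenerate:
  assumes "\<not> c1 < apex"
  shows "apex = c1" and "right_end = c1"
  using assms c1_le_right_end right_end_le_apex by auto

lemma fst_integral_le: "(LINT p:K|lborel. fst p) \<le> max_fst"
proof (cases "c1 < apex")
  case True
  then show ?thesis
    using single_crossing_moment(1)[OF excess_integrable excess_integrals(1) excess_crossing]
      excess_integrals(2) by simp
next
  case False
  note d = degenerate[OF False]
  have "(LINT x:{c1..c1}|lborel. x * fibre_length K x) = 0"
    by (rule set_integral_point)
  then show ?thesis
    using fst_split[of c1] by (simp add: d max_fst_def power2_eq_square field_simps)
qed

text \<open>Equality in the crossing argument gives \<open>excess = 0\<close> almost everywhere;
  concavity, through nearby zeros, extends this to every point.\<close>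

lemma fst_extremal:
  assumes lt: "c1 < apex" and eq: "(LINT p:K|lborel. fst p) = max_fst"
  shows "right_end = apex" and "\<And>x. c1 \<le> x \<Longrightarrow> x \<le> apex \<Longrightarrow> fibre_length K x = edge x"
proof -
  obtain k where k: "0 < k" "c2 = k * (apex - c1)" "\<And>x. edge x = k * (apex - x)"
    using edge_line[OF lt] by metis
  have ae: "AE x in lborel. c1 \<le> x \<and> x \<le> apex \<longrightarrow> excess x = 0"
    using single_crossing_moment(2)[OF excess_integrable excess_integrals(1) excess_crossing] lt
      excess_integrals(2)[OF lt] eq by simp
  \<comment> \<open>Otherwise the excess would equal \<open>- edge\<close>, hence be negative, on a
    whole interval before \<open>apex\<close>.\<close>
  show end_apex: "right_end = apex"
  proof (rule ccontr)
    assume "right_end \<noteq> apex"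
    then have "right_end < apex" using right_end_le_apex by simp
    then obtain x where "right_end < x" "x < apex" "excess x = 0"
      using AE_lborel_obtain[OF ae c1_le_right_end] by blast
    then show False using k fibre_length_right[of x] by (simp add: excess_def)
  qed
  \<comment> \<open>A zero to the left of \<open>x\<close> bounds the excess from above; in the next
    claim a zero to the right bounds it from below.\<close>
  have low: "excess x \<le> 0" if x: "c1 < x" "x \<le> apex" for x
  proof -
    obtain y where "c1 < y" "y < x" "excess y = 0"
      using AE_lborel_obtain[OF ae order_refl x] by blast
    then show ?thesis
      using excess_three_points[OF lt, of y x] x end_apex by (simp add: mult_le_0_iff)
  qed
  have high: "0 \<le> excess x" if x: "c1 < x" "x < apex" for x
  proof -
    obtain y where "x < y" "y < apex" "excess y = 0"
      using AE_lborel_obtain[OF ae less_imp_le[OF x(1)] x(2) order_refl] by blast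
    then show ?thesis
      using excess_three_points[OF lt, of x y] x end_apex by (simp add: zero_le_mult_iff)
  qed
  show "fibre_length K x = edge x" if x: "c1 \<le> x" "x \<le> apex" for x
  proof -
    consider "x = c1" | "c1 < x" "x < apex" | "x = apex" using x by linarith
    then show ?thesis
    proof cases
      case 1 then show ?thesis using fibre_length_c1 k(2,3) by simp
    next
      case 2 then show ?thesis using low[of x] high[of x] by (simp add: excess_def)
    next
      \<comment> \<open>At \<open>apex\<close> there is no zero further right, but
        \<open>edge\<close> vanishes and lengths are nonnegative.\<close>
      case 3 then show ?thesis using low[of x] lt k(3) fibre_length_nonneg[of x]
        by (simp add: excess_def)
    qed
  qed
qed

section \<open>The bound for the second coordinate\<close>

text \<open>An upper bound for \<^const>\<open>fibre_moment\<close> that is affine in \<^const>\<open>excess\<close>: the tangent at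
  \<^const>\<open>edge\<close> of the concave function \<open>g \<mapsto> g * (roof x - g / 2)\<close>, which is the
  moment of a fibre of length \<open>g\<close> pushed up to the roof.\<close>
definition moment_bound :: "real \<Rightarrow> real" where
  "moment_bound x = edge x * (roof x - edge x / 2) + excess x * (roof x - edge x)"

text \<open>The two subtracted terms are independent defects: the deviation from the extremal
  length, and the gap between the fibre and the roof.\<close>

lemma fibre_moment_eq:
  "fibre_moment K x =
    moment_bound x - (excess x)\<^sup>2 / 2 - fibre_length K x * (roof x - fibre_top K x)"
  by (simp add: fibre_moment_def moment_bound_def excess_def power2_eq_square field_simps)

lemma fibre_moment_le:
  assumes "0 \<le> x"
  shows "fibre_moment K x \<le> moment_bound x"
proof -
  have "0 \<le> fibre_length K x * (roof x - fibre_top K x)"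
  proof (cases "x \<le> right_end")
    case True
    then show ?thesis using fibre_top_le_roof[of x] fibre_length_nonneg assms by simp
  qed (simp add: fibre_length_right)
  then show ?thesis unfolding fibre_moment_eq using zero_le_power2[of "excess x"] by linarith
qed

text \<open>The factor \<open>roof x - edge x\<close> is affine with slope \<open>s = m + k\<close>.
  As \<open>excess\<close> integrates to zero, its constant part drops out and the slope multiplies
  the first-coordinate defect; the remaining terms give \<open>max_snd\<close>.\<close>

lemma moment_bound_integral:
  assumes lt: "c1 < apex"
  obtains s where "0 < s" "set_integrable lborel {c1..apex} moment_bound"
    "c1 * (c0\<^sup>2 + c0 * c2 + c2\<^sup>2) / 6 + (LINT x:{c1..apex}|lborel. moment_bound x) =
      max_snd + s * ((LINT p:K|lborel. fst p) - max_fst)"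
proof -
  obtain k where k: "0 < k" "c2 = k * (apex - c1)" "\<And>x. edge x = k * (apex - x)"
    using edge_line[OF lt] by metis
  obtain m where m: "0 \<le> m" "c2 = m * c1 + c0" "\<And>x. roof x = m * x + c0"
    using roof_line by metis
  define T where "T = apex"
  \<comment> \<open>This is \<open>edge x * (roof x - edge x / 2)\<close> expanded in powers of
    \<open>x\<close>.\<close>
  let ?q = "\<lambda>x. k * T * (c0 - k * T / 2) + k * (T * m + T * k - c0) * x + (- k * (m + k / 2)) * x\<^sup>2"
  have bound: "moment_bound x = ?q x + ((m + k) * (x * excess x) + (c0 - k * T) * excess x)" for x
    by (simp add: moment_bound_def k(3) m(3) T_def power2_eq_square field_simps)
  have int: "set_integrable lborel {c1..T} (\<lambda>x. (m + k) * (x * excess x))"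
    "set_integrable lborel {c1..T} (\<lambda>x. (c0 - k * T) * excess x)"
    using excess_integrable by (auto simp: T_def)
  have intq: "set_integrable lborel {c1..T} ?q"
    by (intro set_integral_Icc_cont continuous_intros)
  have rel: "k * (T - c1) = m * c1 + c0" using k(2) m(2) by (simp add: T_def)
  have q: "c1 * (c0\<^sup>2 + c0 * c2 + c2\<^sup>2) / 6 + (LINT x:{c1..T}|lborel. ?q x) = max_snd"
  proof -
    have "(LINT x:{c1..T}|lborel. ?q x) = k * T * (c0 - k * T / 2) * (T - c1)
        + k * (T * m + T * k - c0) * (T\<^sup>2 - c1\<^sup>2) / 2 + (- k * (m + k / 2)) * (T ^ 3 - c1 ^ 3) / 3"
      using lt by (subst set_integral_quadratic) (auto simp: T_def)
    also have "\<dots> = max_snd - c1 * (c0\<^sup>2 + c0 * c2 + c2\<^sup>2) / 6" (is "?L = ?R")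
    proof -
      \<comment> \<open>After multiplication by \<open>6 * c1\<close> the slope \<open>m\<close>
        occurs only in the product \<open>m * c1\<close>, which \<open>rel\<close>
        eliminates.\<close>
      have "6 * c1 * ?L = 3 * k * T * (2 * c0 - k * T) * (T - c1) * c1
          + 3 * k * (T * (m * c1) + (T * k - c0) * c1) * (T\<^sup>2 - c1\<^sup>2)
          - k * (2 * (m * c1) + k * c1) * (T ^ 3 - c1 ^ 3)"
        by (simp add: field_simps)
      also have "m * c1 = k * (T - c1) - c0" using rel by simp
      finally have "6 * c1 * ?L = (c0 * c1 + k * (T - c1) * T)\<^sup>2 - c0 * (k * (T - c1)) * T\<^sup>2
          - c1\<^sup>2 * (c0\<^sup>2 + c0 * (k * (T - c1)) + (k * (T - c1))\<^sup>2)"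
        by (simp add: power2_eq_square power3_eq_cube algebra_simps)
      moreover have "6 * c1 * max_snd = (c0 * c1 + c2 * T)\<^sup>2 - c0 * c2 * T\<^sup>2"
        using c1_pos by (simp add: max_snd_def T_def)
      then have "6 * c1 * ?R = (c0 * c1 + c2 * T)\<^sup>2 - c0 * c2 * T\<^sup>2
          - c1\<^sup>2 * (c0\<^sup>2 + c0 * c2 + c2\<^sup>2)"
        by (simp add: right_diff_distrib power2_eq_square)
      ultimately have "6 * c1 * ?L = 6 * c1 * ?R"
        using k(2) by (simp add: T_def)
      then show ?thesis using c1_pos by simp
    qed
    finally show ?thesis by simp
  qed
  have "(LINT x:{c1..T}|lborel. moment_bound x) = (LINT x:{c1..T}|lborel. ?q x)
      + ((m + k) * (LINT x:{c1..T}|lborel. x * excess x) + (c0 - k * T) * (LINT x:{c1..T}|lborel. excess x))"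
    unfolding bound using int intq
    by (simp only: set_integral_add set_integral_mult_right)
  then have "c1 * (c0\<^sup>2 + c0 * c2 + c2\<^sup>2) / 6 + (LINT x:{c1..apex}|lborel. moment_bound x) =
      max_snd + (m + k) * ((LINT p:K|lborel. fst p) - max_fst)"
    using excess_integrals[OF lt] q by (simp add: T_def)
  moreover have "set_integrable lborel {c1..apex} moment_bound"
    using set_integral_add(1)[OF intq set_integral_add(1)[OF int]]
    by (simp add: bound[abs_def] T_def)
  ultimately show thesis using that[of "m + k"] m(1) k(1) by simp
qed

text \<open>For \<open>c1 < apex\<close>, \<open>max_snd\<close> minus the integral of the second
  coordinate is the integral of \<open>moment_bound x - fibre_moment K x\<close> plus
  \<open>s\<close> times the first-coordinate defect. Both summands are nonnegative, so equality
  kills both.\<close>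

lemma snd_integral_le: "(LINT p:K|lborel. snd p) \<le> max_snd"
  and snd_extremal_imp_fst:
    "(LINT p:K|lborel. snd p) = max_snd \<Longrightarrow> (LINT p:K|lborel. fst p) = max_fst"
  and snd_extremal_AE:
    "c1 < apex \<Longrightarrow> (LINT p:K|lborel. snd p) = max_snd \<Longrightarrow>
      AE x in lborel. c1 \<le> x \<and> x \<le> apex \<longrightarrow> fibre_moment K x = moment_bound x"
proof -
  have "(LINT p:K|lborel. snd p) \<le> max_snd \<and>
    ((LINT p:K|lborel. snd p) = max_snd \<longrightarrow> (LINT p:K|lborel. fst p) = max_fst \<and>
      (c1 < apex \<longrightarrow> (AE x in lborel. c1 \<le> x \<and> x \<le> apex \<longrightarrow> fibre_moment K x = moment_bound x)))"
  proof (cases "c1 < apex")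
    case True
    obtain s where s: "0 < s" and int: "set_integrable lborel {c1..apex} moment_bound"
      and val: "c1 * (c0\<^sup>2 + c0 * c2 + c2\<^sup>2) / 6 + (LINT x:{c1..apex}|lborel. moment_bound x) =
        max_snd + s * ((LINT p:K|lborel. fst p) - max_fst)"
      using moment_bound_integral[OF True] by metis
    let ?f = "\<lambda>x. indicator {c1..apex} x *\<^sub>R (moment_bound x - fibre_moment K x)"
    have fint: "set_integrable lborel {c1..apex} (\<lambda>x. moment_bound x - fibre_moment K x)"
      by (intro set_integral_diff int fibre_moment_integrable) simp
    have fval: "(LINT x:{c1..apex}|lborel. moment_bound x - fibre_moment K x) =
        max_snd + s * ((LINT p:K|lborel. fst p) - max_fst) - (LINT p:K|lborel. snd p)"
      using set_integral_diff(2)[OF int fibre_moment_integrable] val snd_split[OF right_end_le_apex]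
      by simp
    have fpos: "AE x in lborel. 0 \<le> ?f x"
      using fibre_moment_le c1_pos by (intro always_eventually) (auto simp: indicator_def)
    have nonneg: "0 \<le> (LINT x:{c1..apex}|lborel. moment_bound x - fibre_moment K x)"
      unfolding set_lebesgue_integral_def by (rule integral_nonneg_AE[OF fpos])
    have neg: "s * ((LINT p:K|lborel. fst p) - max_fst) \<le> 0"
      using s fst_integral_le by (simp add: mult_le_0_iff)
    show ?thesis
    proof (intro conjI impI)
      show "(LINT p:K|lborel. snd p) \<le> max_snd" using nonneg neg fval by simp
      assume eq: "(LINT p:K|lborel. snd p) = max_snd"
      then have "s * ((LINT p:K|lborel. fst p) - max_fst) = 0" using nonneg neg fval by simp
      then show fst: "(LINT p:K|lborel. fst p) = max_fst" using s by simp
      have "integral\<^sup>L lborel ?f = 0"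
        using fval eq fst by (simp add: set_lebesgue_integral_def)
      then have "AE x in lborel. ?f x = 0"
        using integral_nonneg_eq_0_iff_AE[OF fint[unfolded set_integrable_def] fpos] by simp
      then show "AE x in lborel. c1 \<le> x \<and> x \<le> apex \<longrightarrow> fibre_moment K x = moment_bound x"
        by (rule eventually_mono) (auto simp: indicator_def)
    qed
  next
    case False
    note d = degenerate[OF False]
    have "(LINT x:{c1..c1}|lborel. x * fibre_length K x) = 0"
      "(LINT x:{c1..c1}|lborel. fibre_moment K x) = 0"
      by (rule set_integral_point)+
    then show ?thesis
      using fst_split[of c1] snd_split[of c1] c1_pos
      by (simp add: d max_fst_def max_snd_def power2_eq_square field_simps)
  qed
  then show "(LINT p:K|lborel. snd p) \<le> max_snd"
    "(LINT p:K|lborel. snd p) = max_snd \<Longrightarrow> (LINT p:K|lborel. fst p) = max_fst"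
    "c1 < apex \<Longrightarrow> (LINT p:K|lborel. snd p) = max_snd \<Longrightarrow>
      AE x in lborel. c1 \<le> x \<and> x \<le> apex \<longrightarrow> fibre_moment K x = moment_bound x"
    by blast+
qed

section \<open>The extremal body as a convex hull\<close>

text \<open>Almost every fibre between \<open>c1\<close> and \<open>apex\<close> touches the roof.
  Such points accumulate at \<open>apex\<close>, and \<open>K\<close> is closed.\<close>

lemma roof_in_of_snd_extremal:
  assumes eq: "(LINT p:K|lborel. snd p) = max_snd"
  shows "(apex, roof apex) \<in> K"
proof (cases "c1 < apex")
  case True
  note fst = fst_extremal[OF True snd_extremal_imp_fst[OF eq]]
  obtain k where k: "0 < k" "\<And>x. edge x = k * (apex - x)" using edge_line[OF True] by metis
  let ?S = "(\<lambda>x. (x, roof x)) -` K"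
  have "closed ?S" unfolding roof_def
    by (intro continuous_closed_vimage compact_imp_closed K_compact continuous_intros)
  moreover have "\<exists>x\<in>?S. dist x apex < e" if e: "0 < e" for e
  proof -
    obtain x where x: "max c1 (apex - e) < x" "x < apex" "fibre_moment K x = moment_bound x"
    proof (rule AE_lborel_obtain[OF snd_extremal_AE[OF True eq]])
      show "c1 \<le> max c1 (apex - e)" "max c1 (apex - e) < apex" "apex \<le> apex" using True e by auto
    qed (rule that)
    have g: "fibre_length K x = edge x" using fst(2)[of x] x by simp
    \<comment> \<open>With zero excess, the gap to the roof is the only defect left in
      \<open>fibre_moment_eq\<close>.\<close>
    then have "fibre_length K x * (roof x - fibre_top K x) = 0"
      using x(3) by (simp add: fibre_moment_eq excess_def)
    then have "fibre_top K x = roof x" using g k x by simp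
    then have "(x, roof x) \<in> K"
      using fibre_endpoints(1)[OF K_compact K_convex, of x] x c1_pos fst(1) fst_image by simp
    then show ?thesis using x by (intro bexI[of _ x]) (auto simp: dist_real_def)
  qed
  ultimately have "apex \<in> ?S" using closed_approachable by blast
  then show ?thesis by simp
next
  case False
  then show ?thesis using degenerate(1) left_iff[of c1] roof_nonneg[of c1] c1_pos by simp
qed

lemma hull_of_snd_extremal:
  assumes eq: "(LINT p:K|lborel. snd p) = max_snd"
  shows "K = convex hull {(0, c0), (0, 0), (c1, 0), (apex, roof apex)}" (is "K = ?H")
proof
  have corners: "(0, c0) \<in> K" "(0, 0) \<in> K" "(c1, 0) \<in> K"
    using left_iff[of 0] left_iff[of c1] roof_nonneg[of c1] c1_pos c0_nonneg by (auto simp: roof_def)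
  show "?H \<subseteq> K"
    using corners roof_in_of_snd_extremal[OF eq] by (intro hull_minimal K_convex) auto
  have H: "convex ?H" and pts: "(0, c0) \<in> ?H" "(0, 0) \<in> ?H" "(c1, 0) \<in> ?H" "(apex, roof apex) \<in> ?H"
    by (auto intro: hull_inc)
  \<comment> \<open>Stated for any convex \<open>C\<close> because it is applied both to the hull
    and to \<open>K\<close>.\<close>
  have roof_segment: "(x, roof x) \<in> C"
    if "convex C" "(0, c0) \<in> C" "(apex, roof apex) \<in> C" "0 \<le> x" "x \<le> apex" for C x
    using convex_segment_graph[OF that(1-5)] c1_pos c1_le_apex by (simp add: roof_def algebra_simps)
  show "K \<subseteq> ?H"
  proof (rule subrelI)
    fix x y assume xy: "(x, y) \<in> K"
    then have "x \<in> fst ` K" by force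
    then have x: "0 \<le> x" "x \<le> apex" using right_end_le_apex by (auto simp: fst_image)
    note y = below_roof[OF xy]
    have top: "(x, roof x) \<in> ?H" by (rule roof_segment[OF H pts(1,4) x])
    show "(x, y) \<in> ?H"
    proof (cases "x \<le> c1")
      case True
      have "(x, 0) \<in> ?H"
        using convex_segment_graph[OF H pts(2,3) x(1) True c1_pos, of 0] by simp
      then show ?thesis using convex_vertical[OF H _ top] y by blast
    next
      case False
      then have lt: "c1 < apex" using x by simp
      obtain k where k: "c2 = k * (apex - c1)" "\<And>x. edge x = k * (apex - x)"
        using edge_line[OF lt] by metis
      obtain m where m: "c2 = m * c1 + c0" "\<And>x. roof x = m * x + c0"
        using roof_line by metis
      have "(x, roof x) \<in> K"
        by (rule roof_segment[OF K_convex corners(1) roof_in_of_snd_extremal[OF eq] x])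
      \<comment> \<open>The fibre reaches the roof and has length \<open>edge x\<close>, which
        determines its lower end.\<close>
      then have "roof x - edge x \<le> y"
        using fibre_endpoints(3,4)[OF K_compact K_convex \<open>x \<in> fst ` K\<close>] xy
          fst_extremal(2)[OF lt snd_extremal_imp_fst[OF eq], of x] x False by fastforce
      \<comment> \<open>At \<open>c1\<close> this height is \<open>c2 - c2 = 0\<close> and at
        \<open>apex\<close> it is \<open>roof apex\<close>: it runs along the segment joining these
        two corners.\<close>
      moreover have "(x, roof x - edge x) \<in> ?H"
      proof (rule convex_segment_graph[OF H pts(3,4) _ x(2) lt])
        have "(apex - c1) * roof x = (apex - x) * c2 + (x - c1) * roof apex"
          unfolding m(2) by (subst m(1)) (simp add: algebra_simps)
        moreover have "(apex - c1) * edge x = (apex - x) * c2"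
          unfolding k(2) by (subst k(1)) simp
        ultimately show "(apex - c1) * (roof x - edge x) = (apex - x) * 0 + (x - c1) * roof apex"
          by (simp add: right_diff_distrib)
      qed (use False in simp)
      ultimately show ?thesis using convex_vertical[OF H _ top] y by blast
    qed
  qed
qed

end

section \<open>The bounds in terms of the given data\<close>

theorem proposition6p1:
  fixes V c0 c1 c2 b1 b2 :: real
    and K :: "(real \<times> real) set"
  assumes V_pos: "V > 0" and c1_pos: "c1 > 0" and c2_pos: "c2 > 0"
    and c0_nonneg: "c0 \<ge> 0" and c0_le_c2: "c0 \<le> c2"
    and K_compact: "compact K" and K_convex: "convex K"
    and K_vol: "measure lborel K = V"
    and K_left: "K \<inter> {(x1, x2). x1 \<le> c1} =
      {(x1, x2). 0 \<le> x1 \<and> x1 \<le> c1 \<and> 0 \<le> x2 \<and> x2 \<le> (c2 - c0) / c1 * x1 + c0}"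
    and bary: "(b1, b2) = barycenter K"
  shows "c1 * (c0 + c2) / 2 \<le> V \<and> (b1, b2) \<in> K \<and>
    (\<exists>t1. fst ` K = {0..t1} \<and>
      \<comment> \<open>(1)\<close>
      (b1 \<le> (c0^2 * c1^2 - 4 * c0 * c1 * V + 2 * c1 * c2 * V + 4 * V^2) / (6 * c2 * V) \<and>
       b2 \<le> (- (c0^3) * c1^2 + 4 * c0^2 * c1 * V - 4 * c0 * V^2 + 4 * c2 * V^2)
              / (6 * c1 * c2 * V)) \<and>
      \<comment> \<open>(2)\<close>
      (b1 = (c0^2 * c1^2 - 4 * c0 * c1 * V + 2 * c1 * c2 * V + 4 * V^2) / (6 * c2 * V) \<longrightarrow>
         t1 = (2 * V - c0 * c1) / c2 \<and>
         (\<forall>x\<in>{0..c1}. fibre_length K x = (c2 - c0) / c1 * x + c0) \<and>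
         (t1 \<noteq> c1 \<longrightarrow> (\<forall>x\<in>{c1..t1}. fibre_length K x = c2 * ((t1 - x) / (t1 - c1))))) \<and>
      \<comment> \<open>(3)\<close>
      (b2 = (- (c0^3) * c1^2 + 4 * c0^2 * c1 * V - 4 * c0 * V^2 + 4 * c2 * V^2)
              / (6 * c1 * c2 * V) \<longrightarrow>
         b1 = (c0^2 * c1^2 - 4 * c0 * c1 * V + 2 * c1 * c2 * V + 4 * V^2) / (6 * c2 * V) \<and>
         K = convex hull
           {(0, c0), (0, 0), (c1, 0),
            ((2 * V - c0 * c1) / c2,
             (2 * c2 * V - c0 * (2 * V - c0 * c1)) / (c1 * c2))}))"
proof -
  interpret trapezoid_body V c0 c1 c2 K
    by unfold_locales (fact V_pos c1_pos c2_pos c0_nonneg c0_le_c2 K_compact K_convex K_vol K_left)+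
  have b1: "b1 = (LINT p:K|lborel. fst p) / V" and b2: "b2 = (LINT p:K|lborel. snd p) / V"
    using bary K_vol by (simp_all add: barycenter_def)
  \<comment> \<open>Eliminating \<open>V\<close> in favour of \<open>apex\<close> turns the
    numerators of the stated bounds into multiples of \<open>max_fst\<close> and
    \<open>max_snd\<close>.\<close>
  have V: "V = (c2 * apex + c0 * c1) / 2" using c2_apex by simp
  have bound1: "(c0^2 * c1^2 - 4 * c0 * c1 * V + 2 * c1 * c2 * V + 4 * V^2) / (6 * c2 * V) = max_fst / V"
  proof -
    have "c0^2 * c1^2 - 4 * c0 * c1 * V + 2 * c1 * c2 * V + 4 * V^2 = 6 * c2 * max_fst"
      unfolding max_fst_def by (subst (1 2 3) V) (simp add: power2_eq_square field_simps)
    then show ?thesis using c2_pos by simp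
  qed
  have bound2: "(- (c0^3) * c1^2 + 4 * c0^2 * c1 * V - 4 * c0 * V^2 + 4 * c2 * V^2)
      / (6 * c1 * c2 * V) = max_snd / V"
  proof -
    have "6 * c1 * max_snd = (c0 * c1 + c2 * apex)\<^sup>2 - c0 * c2 * apex\<^sup>2"
      using c1_pos by (simp add: max_snd_def)
    moreover have "- (c0^3) * c1^2 + 4 * c0^2 * c1 * V - 4 * c0 * V^2 + 4 * c2 * V^2 =
        c2 * ((c0 * c1 + c2 * apex)\<^sup>2 - c0 * c2 * apex\<^sup>2)"
      by (subst (1 2 3) V) (simp add: power2_eq_square power3_eq_cube field_simps)
    ultimately have "- (c0^3) * c1^2 + 4 * c0^2 * c1 * V - 4 * c0 * V^2 + 4 * c2 * V^2 =
        6 * c1 * c2 * max_snd"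
      by simp
    then show ?thesis using c1_pos c2_pos by simp
  qed
  have top: "(2 * c2 * V - c0 * (2 * V - c0 * c1)) / (c1 * c2) = roof apex"
  proof -
    have "(c1 * c2) * roof apex = (slope * c1) * (c2 * apex) + c0 * c1 * c2"
      by (simp add: roof_def algebra_simps)
    then have "(c1 * c2) * roof apex = 2 * c2 * V - c0 * (2 * V - c0 * c1)"
      unfolding slope_c1 c2_apex by (simp add: algebra_simps)
    then show ?thesis using c1_pos c2_pos by (simp add: divide_eq_eq mult.commute)
  qed
  have volume: "c1 * (c0 + c2) / 2 \<le> V"
    using mult_left_mono[OF c1_le_apex, of c2] c2_pos V by (simp add: algebra_simps)
  have extremal: "right_end = (2 * V - c0 * c1) / c2 \<and>
      (\<forall>x\<in>{0..c1}. fibre_length K x = (c2 - c0) / c1 * x + c0) \<and>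
      (right_end \<noteq> c1 \<longrightarrow>
        (\<forall>x\<in>{c1..right_end}. fibre_length K x = c2 * ((right_end - x) / (right_end - c1))))"
    if "(LINT p:K|lborel. fst p) = max_fst"
  proof (intro conjI ballI impI)
    \<comment> \<open>If \<open>apex = c1\<close>, both ends are squeezed to \<open>c1\<close>;
      otherwise extremality identifies them.\<close>
    show "right_end = (2 * V - c0 * c1) / c2"
      using fst_extremal(1)[OF _ that] degenerate unfolding apex_def[symmetric]
      by (cases "c1 < apex") simp_all
    show "fibre_length K x = (c2 - c0) / c1 * x + c0" if "x \<in> {0..c1}" for x
      using fibre_left(1)[of x] that by (simp add: roof_def slope_def)
    assume ne: "right_end \<noteq> c1"
    then have "c1 < apex" using c1_le_right_end right_end_le_apex by simp
    then show "fibre_length K x = c2 * ((right_end - x) / (right_end - c1))"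
      if "x \<in> {c1..right_end}" for x
      using fst_extremal[OF _ \<open>(LINT p:K|lborel. fst p) = max_fst\<close>] that by (simp add: edge_def)
  qed
  have eq_iff: "z / V = w / V \<longleftrightarrow> z = w" and le_iff: "z / V \<le> w / V \<longleftrightarrow> z \<le> w" for z w :: real
    using V_pos by (auto simp: divide_le_cancel)
  have "(b1, b2) \<in> K"
    unfolding bary by (rule barycenter_in) (simp_all add: K_compact K_convex K_vol V_pos)
  then show ?thesis
    unfolding bound1 bound2 top unfolding b1 b2 eq_iff le_iff
    using volume fst_image fst_integral_le snd_integral_le extremal
      snd_extremal_imp_fst hull_of_snd_extremal[unfolded apex_def]
    by (intro conjI exI[of _ right_end]) (auto simp only: apex_def)
qed

end
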